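(* Let $r>1$ be an integer and $\alpha>0$ a real number, and define $$f_{\alpha}^{[r]}(x)=(1+x)^{-r\alpha}\sum_{k=0}^{\infty}\binom{-\alpha}{k}^r\left(\frac{x}{1+x}\right)^{rk},\quad x\geq 0.$$ Then for all $x\ge 0$ the following representation as a generalized multivariate Laplace transform holds: $$f_{\alpha}^{[r]}(x)=\frac{1}{(2\pi)^{r-1}\Gamma(\alpha)^r}\int_{(0,\infty)^r}\int_{(-\pi,\pi)^{r-1}}e^{-x g(t,\varphi)}\exp\left\{-\sum_{j=1}^r t_j\right\}\prod_{j=1}^r t_j^{\alpha-1}\,dt\,d\varphi,$$ where $dt=d(t_1,\ldots,t_r)$ with $t=(t_1,\ldots,t_r)\in(0,\infty)^r$, $d\varphi=d(\varphi_1,\ldots,\varphi_{r-1})$ with $\varphi=(\varphi_1,\ldots,\varphi_{r-1})\in(-\pi,\pi)^{r-1}$, and $$g(t,\varphi)=\sum_{j=1}^r t_j+\prod_{j=1}^r t_j^{1/r}\left\{\sum_{j=1}^{r-1}e^{i\varphi_j}+\exp\left(-i\sum_{j=1}^{r-1}\varphi_j\right)\right\}.$$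
   Context: Here $\binom{-\alpha}{k}=\frac{(-\alpha)(-\alpha-1)\cdots(-\alpha-k+1)}{k!}$ is the generalized binomial coefficient, $0^0=1$, and $\Gamma$ is the Gamma function. The integrals are Lebesgue integrals of complex-valued functions. *)

theory Defs
  imports "HOL-Analysis.Analysis"
begin

definition f_series_term :: "nat \<Rightarrow> real \<Rightarrow> real \<Rightarrow> nat \<Rightarrow> real" where
  "f_series_term r \<alpha> x k = ((- \<alpha>) gchoose k) ^ r * (x / (1 + x)) ^ (r * k)"

definition f_alpha :: "nat \<Rightarrow> real \<Rightarrow> real \<Rightarrow> real" where
  "f_alpha r \<alpha> x = (1 + x) powr (- (real r * \<alpha>)) * (\<Sum>k. f_series_term r \<alpha> x k)"

text \<open>
  Points of \<open>n\<close>-dimensional space are functions \<open>nat \<Rightarrow> real\<close> with coordinates indexed by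
  \<open>{1..n}\<close> and the value \<open>undefined\<close> elsewhere.
\<close>

definition lborel_n :: "nat \<Rightarrow> (nat \<Rightarrow> real) measure" where
  "lborel_n n = PiM {1..n} (\<lambda>_. lborel)"

definition positive_orthant :: "nat \<Rightarrow> (nat \<Rightarrow> real) set" where
  "positive_orthant n = (\<Pi>\<^sub>E j\<in>{1..n}. {0<..})"

definition angle_box :: "nat \<Rightarrow> (nat \<Rightarrow> real) set" where
  "angle_box n = (\<Pi>\<^sub>E j\<in>{1..n}. {- pi<..<pi})"

definition g_phase :: "nat \<Rightarrow> (nat \<Rightarrow> real) \<Rightarrow> (nat \<Rightarrow> real) \<Rightarrow> complex" where
  "g_phase r t \<phi> =
     complex_of_real (\<Sum>j=1..r. t j) +
     complex_of_real (\<Prod>j=1..r. t j powr (1 / real r)) *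
       ((\<Sum>j=1..r-1. exp (\<i> * complex_of_real (\<phi> j))) +
        exp (- \<i> * complex_of_real (\<Sum>j=1..r-1. \<phi> j)))"

definition laplace_integrand ::
  "nat \<Rightarrow> real \<Rightarrow> real \<Rightarrow> (nat \<Rightarrow> real) \<times> (nat \<Rightarrow> real) \<Rightarrow> complex" where
  "laplace_integrand r \<alpha> x = (\<lambda>(t, \<phi>).
     exp (- complex_of_real x * g_phase r t \<phi>) *
     complex_of_real (exp (- (\<Sum>j=1..r. t j))) *
     complex_of_real (\<Prod>j=1..r. t j powr (\<alpha> - 1)))"

end

theory Submission
  imports Defs
begin

text \<open>
  Put \<open>c = - x * \<Prod>j. t j powr (1 / r)\<close>. In the integrand, only the factor
  \<open>exp (c * exp (- \<i> * \<Sum>j. \<phi> j))\<close> couples the angles. Expanding it alone in its power series makes the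
  \<open>k\<close>-th term a product over \<open>j\<close> of \<open>exp (c * exp (\<i> * \<phi> j)) * exp (- \<i> * k * \<phi> j)\<close>, each of which
  integrates to \<open>2 * pi * c ^ k / k!\<close>. The remaining integral over \<open>t\<close> is a product of Gamma
  integrals, because \<open>c ^ (r * k)\<close> is \<open>(- x) ^ (r * k)\<close> times the product of the \<open>t j ^ k\<close>.
\<close>

section \<open>Termwise integration of dominated series\<close>

text \<open>Dominated convergence applied to the partial sums: a bound \<open>w\<close> on the
  partial sums of the norms bounds every single term and, by the triangle inequality, every partial
  sum. The three conclusions share these hypotheses, which are checked once for the angular integral
  and once for the full integral.\<close>

lemma
  fixes F :: "nat \<Rightarrow> 'a \<Rightarrow> 'b::{banach, second_countable_topology}" and w :: "'a \<Rightarrow> real"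
  assumes F: "\<And>k. F k \<in> borel_measurable M" and w: "integrable M w"
    and sums: "\<And>y. y \<in> space M \<Longrightarrow> (\<lambda>k. F k y) sums f y"
    and bound: "\<And>n y. y \<in> space M \<Longrightarrow> (\<Sum>k<n. norm (F k y)) \<le> w y"
  shows dominated_integrable_term: "\<And>k. integrable M (F k)"
    and dominated_integrable_sums: "integrable M f"
    and dominated_integral_sums: "(\<lambda>k. integral\<^sup>L M (F k)) sums integral\<^sup>L M f"
proof -
  have lim: "(\<lambda>n. \<Sum>k<n. F k y) \<longlonglongrightarrow> f y" if "y \<in> space M" for y
    using sums[OF that] by (simp add: sums_def)
  have meas: "(\<lambda>y. \<Sum>k<n. F k y) \<in> borel_measurable M" for n
    using F by (rule borel_measurable_sum)
  have f: "f \<in> borel_measurable M"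
    by (rule borel_measurable_LIMSEQ_metric[where f = "\<lambda>n y. \<Sum>k<n. F k y", OF meas lim])
  \<comment> \<open>The term with index \<open>k\<close> first occurs in the partial sum up to
    \<open>Suc k\<close>; the other summands there are nonnegative.\<close>
  have le: "norm (F k y) \<le> w y" if "y \<in> space M" for k y
    using bound[OF that, of "Suc k"] sum_nonneg[of "{..<k}" "\<lambda>k. norm (F k y)"] by auto
  show int: "integrable M (F k)" for k
  proof (rule Bochner_Integration.integrable_bound[OF w F AE_I2])
    show "norm (F k y) \<le> norm (w y)" if "y \<in> space M" for y
      using le[OF that, of k] by simp
  qed
  have *: "AE y in M. norm (\<Sum>k<n. F k y) \<le> w y" for n
    by (rule AE_I2) (rule order_trans[OF norm_sum bound])
  show "integrable M f"
    by (rule integrable_dominated_convergence[where s = "\<lambda>n y. \<Sum>k<n. F k y", OF f meas w AE_I2[OF lim] *])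
  have "(\<lambda>n. integral\<^sup>L M (\<lambda>y. \<Sum>k<n. F k y)) \<longlonglongrightarrow> integral\<^sup>L M f"
    by (rule integral_dominated_convergence[where s = "\<lambda>n y. \<Sum>k<n. F k y", OF f meas w AE_I2[OF lim] *])
  then show "(\<lambda>k. integral\<^sup>L M (F k)) sums integral\<^sup>L M f"
    by (simp add: sums_def int)
qed

section \<open>One-dimensional integrals: Gamma function and circle\<close>

text \<open>For \<open>c = 1\<close> this is Euler's integral. The general case is the substitution
  of \<open>c * t\<close> for \<open>t\<close>, which preserves the half-line because
  \<open>c > 0\<close>.\<close>

lemma has_bochner_integral_Gamma:
  fixes s c :: real
  assumes "s > 0" "c > 0"
  shows "has_bochner_integral lborel (\<lambda>t. indicator {0<..} t * (t powr (s - 1) * exp (- (c * t))))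
    (Gamma s / c powr s)"
proof -
  let ?g = "\<lambda>t::real. indicator {0<..} t * (t powr (s - 1) * exp (- t))"
  have "(\<integral>\<^sup>+t. ennreal (?g t) \<partial>lborel) = ennreal (Gamma s)"
    unfolding Gamma_conv_nn_integral_real[OF assms(1)]
    by (intro nn_integral_cong) (auto simp: indicator_def exp_minus field_simps)
  then have "has_bochner_integral lborel ?g (Gamma s)"
    using assms by (intro has_bochner_integral_nn_integral) (auto simp: indicator_def Gamma_real_nonneg)
  then have "has_bochner_integral lborel (\<lambda>t. ?g (0 + c * t)) (Gamma s /\<^sub>R \<bar>c\<bar>)"
    using lborel_has_bochner_integral_real_affine_iff[of c ?g "Gamma s" 0] assms by simp
  \<comment> \<open>The factor \<open>c powr (1 - s)\<close> cancels the power of \<open>c\<close>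
    that the substitution leaves in front of \<open>t powr (s - 1)\<close>.\<close>
  then have "has_bochner_integral lborel (\<lambda>t. c powr (1 - s) * ?g (0 + c * t))
      (c powr (1 - s) * (Gamma s /\<^sub>R \<bar>c\<bar>))"
    by (intro has_bochner_integral_mult_right) auto
  also have "(\<lambda>t. c powr (1 - s) * ?g (0 + c * t)) =
      (\<lambda>t. indicator {0<..} t * (t powr (s - 1) * exp (- (c * t))))"
  proof
    fix t
    have "c powr (1 - s) * c powr (s - 1) = 1"
      using assms by (simp flip: powr_add)
    then show "c powr (1 - s) * ?g (0 + c * t) = indicator {0<..} t * (t powr (s - 1) * exp (- (c * t)))"
      using assms by (auto simp: indicator_def powr_mult zero_less_mult_iff)
  qed
  also have "c powr (1 - s) * (Gamma s /\<^sub>R \<bar>c\<bar>) = Gamma s / c powr s"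
    using assms by (simp add: powr_diff field_simps)
  finally show ?thesis .
qed

text \<open>Orthogonality of the characters of the circle: for \<open>m\<close> nonzero the
  antiderivative is again a multiple of the character, so by periodicity it agrees at both
  endpoints; for \<open>m = 0\<close> the integrand is 1.\<close>

lemma has_bochner_integral_Ioo_character:
  fixes m :: int
  shows "has_bochner_integral lborel
    (\<lambda>\<phi>. indicator {- pi<..<pi} \<phi> *\<^sub>R exp (\<i> * of_int m * complex_of_real \<phi>))
    (if m = 0 then 2 * pi else 0)"
proof -
  let ?f = "\<lambda>\<phi>. exp (\<i> * of_int m * complex_of_real \<phi>)"
  define F where "F = (\<lambda>\<phi>. if m = 0 then complex_of_real \<phi> else ?f \<phi> / (\<i> * of_int m))"
  have "has_bochner_integral lborel (\<lambda>\<phi>. indicator {- pi..pi} \<phi> *\<^sub>R ?f \<phi>) (F pi - F (- pi))"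
  proof (rule has_bochner_integral_FTC_Icc)
    show "(F has_vector_derivative ?f \<phi>) (at \<phi> within {- pi..pi})" for \<phi>
      unfolding F_def by (cases "m = 0") (auto intro!: derivative_eq_intros has_vector_derivative_real_field)
  qed (auto intro!: continuous_intros)
  also have "F pi - F (- pi) = (if m = 0 then 2 * pi else 0)"
  proof (cases "m = 0")
    case False
    have "?f pi = ?f (- pi) * exp (2 * of_int m * of_real pi * \<i>)"
      unfolding exp_add[symmetric] by (rule arg_cong[of _ _ exp]) (simp add: algebra_simps)
    also have "exp (2 * of_int m * of_real pi * \<i>) = 1"
      using exp_integer_2pi[of "of_int m"] by (simp add: mult_ac)
    finally show ?thesis using False by (simp add: F_def)
  qed (simp add: F_def)
  finally have "has_bochner_integral lborel (\<lambda>\<phi>. indicator {- pi..pi} \<phi> *\<^sub>R ?f \<phi>)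
    (if m = 0 then 2 * pi else 0)" .
  \<comment> \<open>The fundamental theorem gives the integral over the closed interval; the two
    endpoints form a null set.\<close>
  moreover have "has_bochner_integral lborel (\<lambda>\<phi>. indicator {- pi..pi} \<phi> *\<^sub>R ?f \<phi>) v \<longleftrightarrow>
    has_bochner_integral lborel (\<lambda>\<phi>. indicator {- pi<..<pi} \<phi> *\<^sub>R ?f \<phi>) v" for v
    by (rule has_bochner_integral_discrete_difference[of "{- pi, pi}"]) (auto simp: indicator_def)
  ultimately show ?thesis
    by blast
qed

text \<open>The value is 2 pi times the Fourier coefficient of index \<open>k\<close> of
  \<open>exp (c * exp (\<i> * \<phi>))\<close>. Expanding the outer exponential gives a series of
  characters of index \<open>n - k\<close>, and orthogonality leaves only \<open>n = k\<close>. The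
  constant \<open>exp (norm c)\<close> on the bounded interval is the majorant.\<close>

lemma has_bochner_integral_exp_circle:
  fixes c :: complex and k :: nat
  shows "has_bochner_integral lborel (\<lambda>\<phi>. indicator {- pi<..<pi} \<phi> *\<^sub>R
      (exp (c * exp (\<i> * complex_of_real \<phi>)) * exp (- \<i> * of_nat k * complex_of_real \<phi>)))
    (2 * pi * (c ^ k / fact k))"
proof -
  let ?h = "\<lambda>n \<phi>. indicator {- pi<..<pi} \<phi> *\<^sub>R exp (\<i> * of_int (int n - int k) * complex_of_real \<phi>)"
  let ?F = "\<lambda>n \<phi>. c ^ n / fact n * ?h n \<phi>"
  let ?f = "\<lambda>\<phi>. indicator {- pi<..<pi} \<phi> *\<^sub>R
      (exp (c * exp (\<i> * complex_of_real \<phi>)) * exp (- \<i> * of_nat k * complex_of_real \<phi>))"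
  let ?w = "\<lambda>\<phi>. indicator {- pi<..<pi} \<phi> * exp (norm c)"
  have F: "has_bochner_integral lborel (?F n) (c ^ n / fact n * (if int n - int k = 0 then 2 * pi else 0))" for n
    by (intro has_bochner_integral_mult_right has_bochner_integral_Ioo_character)
  have meas: "?F n \<in> borel_measurable lborel" for n
    using F[of n] by (rule borel_measurable_has_bochner_integral)
  have w: "integrable lborel ?w"
    by (intro integrable_mult_left) simp
  have sums: "(\<lambda>n. ?F n \<phi>) sums ?f \<phi>" for \<phi>
  proof -
    have "(\<lambda>n. (c * exp (\<i> * complex_of_real \<phi>)) ^ n /\<^sub>R fact n) sums exp (c * exp (\<i> * complex_of_real \<phi>))"
      by (rule exp_converges)
    then have "(\<lambda>n. indicator {- pi<..<pi} \<phi> *\<^sub>R ((c * exp (\<i> * complex_of_real \<phi>)) ^ n /\<^sub>R fact n *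
        exp (- \<i> * of_nat k * complex_of_real \<phi>))) sums ?f \<phi>"
      by (intro sums_scaleR_right sums_mult2)
    also have "(\<lambda>n. indicator {- pi<..<pi} \<phi> *\<^sub>R ((c * exp (\<i> * complex_of_real \<phi>)) ^ n /\<^sub>R fact n *
        exp (- \<i> * of_nat k * complex_of_real \<phi>))) = (\<lambda>n. ?F n \<phi>)"
    proof
      fix n
      have "exp (\<i> * complex_of_real \<phi>) ^ n * exp (- \<i> * of_nat k * complex_of_real \<phi>) =
          exp (\<i> * of_int (int n - int k) * complex_of_real \<phi>)"
        by (simp flip: exp_of_nat_mult exp_add add: algebra_simps)
      then show "indicator {- pi<..<pi} \<phi> *\<^sub>R ((c * exp (\<i> * complex_of_real \<phi>)) ^ n /\<^sub>R fact n *
          exp (- \<i> * of_nat k * complex_of_real \<phi>)) = ?F n \<phi>"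
        by (simp add: power_mult_distrib scaleR_conv_of_real field_simps)
    qed
    finally show ?thesis .
  qed
  have bound: "(\<Sum>n<N. norm (?F n \<phi>)) \<le> ?w \<phi>" for N \<phi>
  proof -
    \<comment> \<open>Characters have modulus 1, so the norms of the terms are those of the
      exponential series at \<open>norm c\<close>.\<close>
    have "(\<Sum>n<N. norm c ^ n /\<^sub>R fact n) \<le> exp (norm c)"
      using exp_converges[of "norm c"] by (intro sum_le_suminf[THEN order_trans])
        (auto simp: sums_iff)
    then show ?thesis
      by (auto simp: indicator_def norm_mult norm_divide norm_power divide_inverse mult.commute norm_inverse)
  qed
  note ds = meas w sums bound
  have "(\<lambda>n. integral\<^sup>L lborel (?F n)) sums integral\<^sup>L lborel ?f"
    by (rule dominated_integral_sums[OF ds])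
  also have "(\<lambda>n. integral\<^sup>L lborel (?F n)) = (\<lambda>n. if n = k then 2 * pi * (c ^ n / fact n) else 0)"
    by (rule ext, subst has_bochner_integral_integral_eq[OF F]) auto
  finally have "(\<lambda>n. if n = k then 2 * pi * (c ^ n / fact n) else 0) sums integral\<^sup>L lborel ?f" .
  moreover have "(\<lambda>n. if n = k then 2 * pi * (c ^ n / fact n) else 0) sums (2 * pi * (c ^ k / fact k))"
    by (rule sums_single)
  ultimately have "integral\<^sup>L lborel ?f = 2 * pi * (c ^ k / fact k)"
    by (rule sums_unique2)
  moreover have "integrable lborel ?f"
    by (rule dominated_integrable_sums[OF ds])
  ultimately show ?thesis
    by (simp add: has_bochner_integral_iff)
qed


section \<open>Terms of the expansion\<close>

text \<open>The indicator of the half-line sits inside each factor, so that the weight is a product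
  of one-variable functions and vanishes off the orthant. The rate \<open>c\<close> is
  \<open>1 + x\<close> in the terms of the series and 1 in their majorant; \<open>s\<close> is
  \<alpha>, or \<alpha> + k once powers of the coordinates are absorbed.\<close>

definition orthant_weight :: "nat \<Rightarrow> real \<Rightarrow> real \<Rightarrow> (nat \<Rightarrow> real) \<Rightarrow> real" where
  "orthant_weight r s c t =
     (\<Prod>j=1..r. indicator {0<..} (t j) * (t j powr (s - 1) * exp (- (c * t j))))"

definition geo_mean :: "nat \<Rightarrow> (nat \<Rightarrow> real) \<Rightarrow> real" where
  "geo_mean r t = (\<Prod>j=1..r. t j powr (1 / real r))"

definition circle_factor :: "complex \<Rightarrow> nat \<Rightarrow> real \<Rightarrow> complex" where
  "circle_factor c k \<phi> = indicator {- pi<..<pi} \<phi> *\<^sub>R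
     (exp (c * exp (\<i> * complex_of_real \<phi>)) * exp (- \<i> * of_nat k * complex_of_real \<phi>))"

text \<open>The rate \<open>1 + x\<close> merges \<open>exp (- t j)\<close> with the decay from the
  Laplace kernel. The last factor is the coefficient from expanding the exponential that couples the
  angles; the phase of that term is distributed over the circle factors.\<close>

definition laplace_term ::
  "nat \<Rightarrow> real \<Rightarrow> real \<Rightarrow> nat \<Rightarrow> (nat \<Rightarrow> real) \<times> (nat \<Rightarrow> real) \<Rightarrow> complex" where
  "laplace_term r \<alpha> x k = (\<lambda>(t, \<phi>).
     of_real (orthant_weight r \<alpha> (1 + x) t) *
     (\<Prod>j=1..r-1. circle_factor (of_real (- x * geo_mean r t)) k (\<phi> j)) *
     (of_real (- x * geo_mean r t) ^ k / fact k))"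

section \<open>Product measures and measurability\<close>

lemma product_sigma_finite_lborel: "product_sigma_finite (\<lambda>_. lborel)"
  by standard

lemma sigma_finite_lborel_n: "sigma_finite_measure (lborel_n n)"
  unfolding lborel_n_def
  by (rule product_sigma_finite.sigma_finite[OF product_sigma_finite_lborel]) simp

lemma pair_sigma_finite_lborel_n: "pair_sigma_finite (lborel_n m) (lborel_n n)"
  by (intro pair_sigma_finite.intro sigma_finite_lborel_n)

lemma has_bochner_integral_lborel_n_prod:
  fixes f :: "real \<Rightarrow> 'b::{real_normed_field, banach, second_countable_topology}"
  assumes "has_bochner_integral lborel f v"
  shows "has_bochner_integral (lborel_n n) (\<lambda>y. \<Prod>j=1..n. f (y j)) (v ^ n)"
proof -
  interpret product_sigma_finite "\<lambda>_::nat. lborel :: real measure"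
    by (rule product_sigma_finite_lborel)
  have "integrable lborel f" "integral\<^sup>L lborel f = v"
    using assms by (simp_all add: has_bochner_integral_iff)
  then show ?thesis
    unfolding lborel_n_def has_bochner_integral_iff
    using product_integrable_prod[of "{1..n}" "\<lambda>_. f"] product_integral_prod[of "{1..n}" "\<lambda>_. f"]
    by simp
qed

lemma measurable_fst_component:
  "j \<in> {1..m} \<Longrightarrow> (\<lambda>p. fst p j) \<in> borel_measurable (lborel_n m \<Otimes>\<^sub>M lborel_n n)"
  unfolding lborel_n_def
  using measurable_compose[OF measurable_fst measurable_component_singleton[of j "{1..m}" "\<lambda>_. lborel"]]
  by simp

lemma measurable_snd_component:
  "j \<in> {1..n} \<Longrightarrow> (\<lambda>p. snd p j) \<in> borel_measurable (lborel_n m \<Otimes>\<^sub>M lborel_n n)"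
  unfolding lborel_n_def
  using measurable_compose[OF measurable_snd measurable_component_singleton[of j "{1..n}" "\<lambda>_. lborel"]]
  by simp

lemma measurable_laplace_term:
  "laplace_term r \<alpha> x k \<in> borel_measurable (lborel_n r \<Otimes>\<^sub>M lborel_n (r - 1))"
proof -
  note [measurable] = measurable_fst_component[of _ r "r - 1"] measurable_snd_component[of _ "r - 1" r]
  have [measurable]: "(\<lambda>p. geo_mean r (fst p)) \<in> borel_measurable (lborel_n r \<Otimes>\<^sub>M lborel_n (r - 1))"
    unfolding geo_mean_def by measurable
  have [measurable]: "(\<lambda>p. orthant_weight r \<alpha> (1 + x) (fst p)) \<in> borel_measurable (lborel_n r \<Otimes>\<^sub>M lborel_n (r - 1))"
    unfolding orthant_weight_def by measurable
  have [measurable]: "(\<lambda>p. circle_factor (of_real (- x * geo_mean r (fst p))) k (snd p j))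
      \<in> borel_measurable (lborel_n r \<Otimes>\<^sub>M lborel_n (r - 1))" if "j \<in> {1..r-1}" for j
    unfolding circle_factor_def using that by measurable
  show ?thesis
    unfolding laplace_term_def case_prod_beta by measurable
qed

section \<open>Geometric mean and weight on the orthant\<close>

lemma geo_mean_nonneg: "geo_mean r t \<ge> 0"
  unfolding geo_mean_def by (intro prod_nonneg) simp

lemma geo_mean_le_sum:
  assumes "r > 0" and "\<And>j. j \<in> {1..r} \<Longrightarrow> t j > 0"
  shows "real r * geo_mean r t \<le> (\<Sum>j=1..r. t j)"
proof -
  have "geo_mean r t = (\<Prod>j=1..r. t j) powr (1 / real r)"
    unfolding geo_mean_def by (rule prod_powr_distrib[symmetric])
  also have "\<dots> \<le> (\<Sum>j=1..r. t j / real r)"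
    using arith_geom_mean[of "{1..r}" t] assms by (auto intro: less_imp_le)
  finally show ?thesis
    using assms(1) by (simp add: field_simps flip: sum_divide_distrib)
qed

lemma geo_mean_power:
  assumes "r > 0" and "\<And>j. j \<in> {1..r} \<Longrightarrow> t j > 0"
  shows "geo_mean r t ^ r = (\<Prod>j=1..r. t j)"
  unfolding geo_mean_def prod_power_distrib
  using assms by (intro prod.cong refl) (force simp: powr_power)

lemma orthant_weight_pos:
  assumes "\<And>j. j \<in> {1..r} \<Longrightarrow> t j > 0"
  shows "orthant_weight r s c t = exp (- (c * (\<Sum>j=1..r. t j))) * (\<Prod>j=1..r. t j powr (s - 1))"
proof -
  have "orthant_weight r s c t = (\<Prod>j=1..r. exp (- (c * t j)) * t j powr (s - 1))"
    unfolding orthant_weight_def using assms by (intro prod.cong refl) (simp add: indicator_def)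
  then show ?thesis
    by (simp add: prod.distrib exp_sum sum_distrib_left flip: sum_negf)
qed

lemma orthant_weight_eq_0:
  assumes "j \<in> {1..r}" "t j \<le> 0"
  shows "orthant_weight r s c t = 0"
  unfolding orthant_weight_def using assms by (intro prod_zero bexI[of _ j]) auto

lemma orthant_weight_nonneg: "orthant_weight r s c t \<ge> 0"
  unfolding orthant_weight_def by (intro prod_nonneg) simp

text \<open>The power \<open>k * r\<close> of the \<open>r\<close>-th root of \<open>t j\<close> is
  \<open>t j ^ k\<close>, which shifts every Gamma exponent by \<open>k\<close>. If some coordinate
  is not positive, both sides vanish.\<close>

lemma orthant_weight_geo_mean_power:
  assumes "r > 0"
  shows "orthant_weight r s c t * (geo_mean r t ^ k) ^ r = orthant_weight r (s + real k) c t"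
proof (cases "\<forall>j\<in>{1..r}. t j > 0")
  case True
  have "(geo_mean r t ^ k) ^ r = (geo_mean r t ^ r) ^ k"
    by (simp add: mult.commute flip: power_mult)
  also have "\<dots> = (\<Prod>j=1..r. t j ^ k)"
    using geo_mean_power[OF assms, of t] True by (simp add: prod_power_distrib)
  also have "\<dots> = (\<Prod>j=1..r. t j powr real k)"
    using True by (intro prod.cong refl) (simp add: powr_realpow)
  finally have "(geo_mean r t ^ k) ^ r = (\<Prod>j=1..r. t j powr real k)" .
  moreover have "orthant_weight r u c t = exp (- (c * (\<Sum>j=1..r. t j))) * (\<Prod>j=1..r. t j powr (u - 1))" for u
    using True by (intro orthant_weight_pos) blast
  ultimately show ?thesis
    by (simp add: algebra_simps flip: prod.distrib powr_add)
next
  case False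
  then show ?thesis
    by (auto simp: orthant_weight_eq_0 not_less)
qed

section \<open>Integrals over the orthant and the box\<close>

lemma has_bochner_integral_orthant_weight:
  assumes "s > 0" "c > 0"
  shows "has_bochner_integral (lborel_n r) (orthant_weight r s c) ((Gamma s / c powr s) ^ r)"
  unfolding orthant_weight_def
  by (rule has_bochner_integral_lborel_n_prod[OF has_bochner_integral_Gamma[OF assms]])

lemma has_bochner_integral_circle_factor:
  "has_bochner_integral (lborel_n n) (\<lambda>\<phi>. \<Prod>j=1..n. circle_factor c k (\<phi> j))
     ((of_real (2 * pi) * (c ^ k / fact k)) ^ n)"
  using has_bochner_integral_lborel_n_prod[OF has_bochner_integral_exp_circle[of c k]]
  unfolding circle_factor_def .

text \<open>A product of an integrable function of \<open>t\<close> and an integrable function of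
  the angles. It dominates the whole expansion; rate 1 is what remains of \<open>1 + x\<close> after
  the angular exponentials are bounded.\<close>

lemma integrable_majorant:
  assumes "\<alpha> > 0"
  shows "integrable (lborel_n m \<Otimes>\<^sub>M lborel_n n)
    (\<lambda>p. orthant_weight m \<alpha> 1 (fst p) * (\<Prod>j=1..n. indicator {- pi<..<pi} (snd p j)))"
proof -
  interpret pair_sigma_finite "lborel_n m" "lborel_n n"
    by (rule pair_sigma_finite_lborel_n)
  have 1: "integrable (lborel_n m) (orthant_weight m \<alpha> 1)"
    using has_bochner_integral_orthant_weight[OF assms, of 1 m] by (auto simp: has_bochner_integral_iff)
  have "has_bochner_integral lborel (indicator {- pi<..<pi} :: real \<Rightarrow> real) (2 * pi)"
    using has_bochner_integral_real_indicator[of "{- pi<..<pi}" lborel] by simp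
  from has_bochner_integral_lborel_n_prod[OF this, of n]
  have 2: "integrable (lborel_n n) (\<lambda>\<phi>. \<Prod>j=1..n. indicator {- pi<..<pi} (\<phi> j) :: real)"
    by (simp add: has_bochner_integral_iff)
  note [measurable] = borel_measurable_integrable[OF 1] borel_measurable_integrable[OF 2]
  show ?thesis
  proof (rule Fubini_integrable)
    show "(\<lambda>p. orthant_weight m \<alpha> 1 (fst p) * (\<Prod>j=1..n. indicator {- pi<..<pi} (snd p j)))
        \<in> borel_measurable (lborel_n m \<Otimes>\<^sub>M lborel_n n)"
      by measurable
  qed (use 1 2 in \<open>auto simp: abs_mult\<close>)
qed

section \<open>Pointwise expansion and domination\<close>

text \<open>Membership in \<open>PiE\<close> also demands the value \<open>undefined\<close> outside
  the index set; points of the product space have it, so only the coordinate conditions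
  remain.\<close>

lemma indicator_orthant_box:
  assumes "(t, \<phi>) \<in> space (lborel_n m \<Otimes>\<^sub>M lborel_n n)"
  shows "indicator (positive_orthant m \<times> angle_box n) (t, \<phi>) =
    (if (\<forall>j\<in>{1..m}. t j > 0) \<and> (\<forall>j\<in>{1..n}. \<phi> j \<in> {- pi<..<pi}) then 1 else (0 :: real))"
  using assms unfolding indicator_def positive_orthant_def angle_box_def lborel_n_def space_pair_measure space_PiM
  by (auto simp: PiE_iff)

lemma laplace_term_outside:
  assumes "\<not> ((\<forall>j\<in>{1..r}. t j > 0) \<and> (\<forall>j\<in>{1..r-1}. \<phi> j \<in> {- pi<..<pi}))"
  shows "laplace_term r \<alpha> x k (t, \<phi>) = 0"
proof (cases "\<forall>j\<in>{1..r}. t j > 0")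
  case True
  then obtain j where "j \<in> {1..r-1}" "\<phi> j \<notin> {- pi<..<pi}"
    using assms by blast
  then have "(\<Prod>j=1..r-1. circle_factor c k (\<phi> j)) = 0" for c
    by (intro prod_zero bexI[of _ j]) (auto simp: circle_factor_def)
  then show ?thesis
    by (simp add: laplace_term_def)
next
  case False
  then show ?thesis
    by (auto simp: laplace_term_def orthant_weight_eq_0 not_less)
qed

text \<open>On the domain the integrand is \<open>W * exp (c * S) * exp (c * e)\<close>, where
  \<open>e\<close> is the phase coupling the angles, and only the last exponential is expanded. Off
  the domain the terms and the sum are 0.\<close>

lemma laplace_term_sums:
  assumes p: "p \<in> space (lborel_n r \<Otimes>\<^sub>M lborel_n (r - 1))"
  shows "(\<lambda>k. laplace_term r \<alpha> x k p) sums
    (indicator (positive_orthant r \<times> angle_box (r - 1)) p *\<^sub>R laplace_integrand r \<alpha> x p)"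
proof (cases p)
  case (Pair t \<phi>)
  note ind = indicator_orthant_box[of t \<phi>, OF p[unfolded Pair]]
  show ?thesis
  proof (cases "(\<forall>j\<in>{1..r}. t j > 0) \<and> (\<forall>j\<in>{1..r-1}. \<phi> j \<in> {- pi<..<pi})")
    case True
    define c where "c = complex_of_real (- x * geo_mean r t)"
    define S where "S = (\<Sum>j=1..r-1. exp (\<i> * complex_of_real (\<phi> j)))"
    define e where "e = exp (- \<i> * complex_of_real (\<Sum>j=1..r-1. \<phi> j))"
    define W where "W = complex_of_real (orthant_weight r \<alpha> (1 + x) t)"
    have W: "W = exp (- of_real x * of_real (\<Sum>j=1..r. t j)) * of_real (exp (- (\<Sum>j=1..r. t j))) *
        of_real (\<Prod>j=1..r. t j powr (\<alpha> - 1))"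
    proof -
      have "orthant_weight r \<alpha> (1 + x) t =
          exp (- x * (\<Sum>j=1..r. t j)) * exp (- (\<Sum>j=1..r. t j)) * (\<Prod>j=1..r. t j powr (\<alpha> - 1))"
        using orthant_weight_pos[of r t] True by (simp add: algebra_simps flip: exp_add)
      then show ?thesis
        by (simp only: W_def of_real_mult of_real_minus flip: exp_of_real)
    qed
    have "exp (- of_real x * g_phase r t \<phi>) = exp (- of_real x * of_real (\<Sum>j=1..r. t j)) * exp (c * S) * exp (c * e)"
      unfolding g_phase_def c_def S_def e_def geo_mean_def
      by (simp add: algebra_simps flip: exp_add)
    then have f: "laplace_integrand r \<alpha> x (t, \<phi>) = W * exp (c * S) * exp (c * e)"
      unfolding laplace_integrand_def W by simp
    have F: "laplace_term r \<alpha> x k (t, \<phi>) = W * exp (c * S) * ((c * e) ^ k /\<^sub>R fact k)" for k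
    proof -
      have "(\<Prod>j=1..r-1. circle_factor c k (\<phi> j)) =
          (\<Prod>j=1..r-1. exp (c * exp (\<i> * complex_of_real (\<phi> j)))) *
          (\<Prod>j=1..r-1. exp (- \<i> * of_nat k * complex_of_real (\<phi> j)))"
        unfolding prod.distrib[symmetric] using True
        by (intro prod.cong refl) (simp add: circle_factor_def indicator_def)
      \<comment> \<open>The angles separate here: \<open>e ^ k\<close> is the exponential of a sum
        over \<open>j\<close>, hence a product of one phase per angle.\<close>
      also have "\<dots> = exp (c * S) * e ^ k"
      proof -
        have "e ^ k = exp (\<Sum>j=1..r-1. - \<i> * of_nat k * complex_of_real (\<phi> j))"
          unfolding e_def exp_of_nat_mult[symmetric] by (simp add: sum_distrib_left sum_negf mult_ac)
        then show ?thesis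
          unfolding S_def sum_distrib_left by (simp only: exp_sum finite_atLeastAtMost)
      qed
      finally show ?thesis
        unfolding laplace_term_def prod.case c_def[symmetric] W_def[symmetric]
        by (simp add: power_mult_distrib scaleR_conv_of_real divide_inverse mult_ac)
    qed
    show ?thesis
      using sums_mult[OF exp_converges[of "c * e"], of "W * exp (c * S)"]
      unfolding Pair F f ind if_P[OF True] by simp
  next
    case False
    then show ?thesis
      unfolding Pair ind if_not_P[OF False] laplace_term_outside[OF False] by simp
  qed
qed

lemma norm_circle_factor_le: "norm (circle_factor c k \<phi>) \<le> exp (norm c)"
proof -
  have "norm (exp (c * exp (\<i> * complex_of_real \<phi>))) \<le> exp (norm (c * exp (\<i> * complex_of_real \<phi>)))"
    by (rule norm_exp)
  then show ?thesis
    by (simp add: circle_factor_def norm_mult indicator_def)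
qed

text \<open>
  The factor \<^term>\<open>exp (x * (real r * geo_mean r t))\<close> that appears when all exponentials are bounded in
  modulus is absorbed, by the AM-GM inequality, into \<^term>\<open>exp (- x * (\<Sum>j=1..r. t j))\<close>.
\<close>

lemma laplace_term_sum_norm_le:
  assumes "r > 0" "x \<ge> 0"
  shows "(\<Sum>k<n. norm (laplace_term r \<alpha> x k p)) \<le>
    orthant_weight r \<alpha> 1 (fst p) * (\<Prod>j=1..r-1. indicator {- pi<..<pi} (snd p j))"
proof (cases p)
  case (Pair t \<phi>)
  show ?thesis
  proof (cases "(\<forall>j\<in>{1..r}. t j > 0) \<and> (\<forall>j\<in>{1..r-1}. \<phi> j \<in> {- pi<..<pi})")
    case True
    let ?P = "x * geo_mean r t"
    let ?W = "orthant_weight r \<alpha> (1 + x) t"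
    have P: "?P \<ge> 0"
      using assms geo_mean_nonneg by simp
    have W: "?W \<ge> 0"
      by (rule orthant_weight_nonneg)
    \<comment> \<open>Each of the \<open>r - 1\<close> circle factors is at most
      \<open>exp ?P\<close> in modulus.\<close>
    have "norm (laplace_term r \<alpha> x k p) \<le> ?W * exp ?P ^ (r - 1) * (?P ^ k /\<^sub>R fact k)" for k
    proof -
      let ?c = "complex_of_real (- x * geo_mean r t)"
      have c: "norm ?c = ?P"
        using P by (simp only: norm_of_real mult_minus_left abs_minus_cancel abs_of_nonneg)
      have "norm (\<Prod>j=1..r-1. circle_factor ?c k (\<phi> j)) \<le> (\<Prod>j=1..r-1. exp ?P)"
        unfolding prod_norm[symmetric] using norm_circle_factor_le[of ?c] unfolding c
        by (intro prod_mono) simp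
      then have "?W * norm (\<Prod>j=1..r-1. circle_factor ?c k (\<phi> j)) * (?P ^ k / fact k) \<le>
          ?W * exp ?P ^ (r - 1) * (?P ^ k / fact k)"
        using W P by (intro mult_right_mono mult_left_mono) auto
      then show ?thesis
        unfolding Pair laplace_term_def prod.case norm_mult norm_divide norm_power c norm_fact norm_of_real
        using W by (simp add: divide_inverse mult_ac abs_of_nonneg[OF P])
    qed
    then have "(\<Sum>k<n. norm (laplace_term r \<alpha> x k p)) \<le> (\<Sum>k<n. ?W * exp ?P ^ (r - 1) * (?P ^ k /\<^sub>R fact k))"
      by (intro sum_mono)
    also have "\<dots> = ?W * exp ?P ^ (r - 1) * (\<Sum>k<n. ?P ^ k /\<^sub>R fact k)"
      by (simp add: sum_distrib_left)
    \<comment> \<open>The partial sums of the expanded exponential supply one more factor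
      \<open>exp ?P\<close>, for \<open>r\<close> of them in total, the number that the AM-GM bound
      can absorb.\<close>
    also have "(\<Sum>k<n. ?P ^ k /\<^sub>R fact k) \<le> exp ?P"
      using exp_converges[of ?P] P by (intro sum_le_suminf[THEN order_trans]) (auto simp: sums_iff)
    also have "?W * exp ?P ^ (r - 1) * exp ?P = ?W * exp (x * (real r * geo_mean r t))"
    proof -
      have "exp ?P ^ (r - 1) * exp ?P = exp ?P ^ r"
        by (rule power_minus_mult[OF assms(1)])
      also have "\<dots> = exp (x * (real r * geo_mean r t))"
        by (simp add: mult_ac flip: exp_of_nat_mult)
      finally show ?thesis by simp
    qed
    also have "\<dots> \<le> ?W * exp (x * (\<Sum>j=1..r. t j))"
      using W geo_mean_le_sum[of r t] True assms by (intro mult_left_mono) (auto intro: mult_left_mono)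
    also have "\<dots> = orthant_weight r \<alpha> 1 t"
      using orthant_weight_pos[of r t] True by (simp add: algebra_simps flip: exp_add)
    also have "\<dots> = orthant_weight r \<alpha> 1 (fst p) * (\<Prod>j=1..r-1. indicator {- pi<..<pi} (snd p j))"
      using True unfolding Pair by (simp add: indicator_def)
    finally show ?thesis
      using W by (simp add: mult_left_mono)
  next
    case False
    then show ?thesis
      unfolding Pair using laplace_term_outside[OF False]
      by (simp add: orthant_weight_nonneg prod_nonneg)
  qed
qed

section \<open>Evaluation of the term integrals\<close>

text \<open>By Fubini the angles are integrated first. The \<open>r - 1\<close> circle integrals
  each contribute \<open>c ^ k / fact k\<close>, and the coefficient of the expansion is the
  \<open>r\<close>-th copy. The resulting \<open>r\<close>-th power turns roots of the coordinates
  into integer powers, and the integral over \<open>t\<close> becomes a product of \<open>r\<close>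
  equal Gamma integrals.\<close>

lemma integral_laplace_term:
  assumes r: "r > 0" and \<alpha>: "\<alpha> > 0" and x: "x \<ge> 0"
    and int: "integrable (lborel_n r \<Otimes>\<^sub>M lborel_n (r - 1)) (laplace_term r \<alpha> x k)"
  shows "integral\<^sup>L (lborel_n r \<Otimes>\<^sub>M lborel_n (r - 1)) (laplace_term r \<alpha> x k) =
    of_real ((2 * pi) ^ (r - 1) * (((- x) ^ k / fact k) * (Gamma (\<alpha> + real k) / (1 + x) powr (\<alpha> + real k))) ^ r)"
proof -
  interpret pair_sigma_finite "lborel_n r" "lborel_n (r - 1)"
    by (rule pair_sigma_finite_lborel_n)
  let ?C = "(2 * pi) ^ (r - 1) * ((- x) ^ k / fact k) ^ r"
  have inner: "(\<integral>\<phi>. laplace_term r \<alpha> x k (t, \<phi>) \<partial>lborel_n (r - 1)) =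
      of_real (?C * orthant_weight r (\<alpha> + real k) (1 + x) t)" for t
  proof -
    let ?c = "- x * geo_mean r t"
    have "(\<integral>\<phi>. laplace_term r \<alpha> x k (t, \<phi>) \<partial>lborel_n (r - 1)) =
        of_real (orthant_weight r \<alpha> (1 + x) t) * (of_real (2 * pi) * (of_real ?c ^ k / fact k)) ^ (r - 1) * (of_real ?c ^ k / fact k)"
      unfolding laplace_term_def prod.case integral_mult_left_zero integral_mult_right_zero
        has_bochner_integral_integral_eq[OF has_bochner_integral_circle_factor] ..
    also have "\<dots> = of_real (orthant_weight r \<alpha> (1 + x) t * ((2 * pi) ^ (r - 1) * ((?c ^ k / fact k) ^ (r - 1) * (?c ^ k / fact k))))"
      by (simp only: of_real_mult of_real_power of_real_divide of_real_fact power_mult_distrib mult_ac)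
    also have "(?c ^ k / fact k) ^ (r - 1) * (?c ^ k / fact k) = (?c ^ k / fact k) ^ r"
      by (rule power_minus_mult[OF r])
    also have "(?c ^ k / fact k) ^ r = ((- x) ^ k / fact k) ^ r * (geo_mean r t ^ k) ^ r"
      by (simp only: power_mult_distrib power_divide) simp
    also have "orthant_weight r \<alpha> (1 + x) t * ((2 * pi) ^ (r - 1) * (((- x) ^ k / fact k) ^ r * (geo_mean r t ^ k) ^ r)) =
        ?C * (orthant_weight r \<alpha> (1 + x) t * (geo_mean r t ^ k) ^ r)"
      by (simp only: mult_ac)
    finally show ?thesis
      by (simp only: orthant_weight_geo_mean_power[OF r])
  qed
  have "integral\<^sup>L (lborel_n r \<Otimes>\<^sub>M lborel_n (r - 1)) (laplace_term r \<alpha> x k) =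
      (\<integral>t. of_real (?C * orthant_weight r (\<alpha> + real k) (1 + x) t) \<partial>lborel_n r)"
    unfolding integral_fst'[OF int, symmetric] inner ..
  also have "\<dots> = of_real (?C * (Gamma (\<alpha> + real k) / (1 + x) powr (\<alpha> + real k)) ^ r)"
    using has_bochner_integral_orthant_weight[of "\<alpha> + real k" "1 + x" r] \<alpha> x
    unfolding integral_complex_of_real by (simp add: has_bochner_integral_iff)
  finally show ?thesis
    by (simp only: power_mult_distrib mult.assoc)
qed

text \<open>\<open>Gamma (\<alpha> + real k)\<close> is \<open>Gamma \<alpha>\<close> times the
  rising factorial, which is the numerator of the binomial coefficient up to the sign
  \<open>(- 1) ^ k\<close>; that sign comes from \<open>(- x) ^ k\<close>.\<close>

lemma f_series_term_Gamma:
  assumes \<alpha>: "\<alpha> > 0" and x: "x \<ge> 0"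
  shows "(2 * pi) ^ (r - 1) * (((- x) ^ k / fact k) * (Gamma (\<alpha> + real k) / (1 + x) powr (\<alpha> + real k))) ^ r =
    (2 * pi) ^ (r - 1) * Gamma \<alpha> ^ r * (1 + x) powr (- (real r * \<alpha>)) * f_series_term r \<alpha> x k"
proof -
  have 1: "Gamma (\<alpha> + real k) = pochhammer \<alpha> k * Gamma \<alpha>"
    using \<alpha> pochhammer_Gamma[of \<alpha> k] Gamma_real_pos[OF \<alpha>, THEN less_imp_neq]
    by (auto simp: nonpos_Ints_def)
  have 2: "(- \<alpha>) gchoose k = (- 1) ^ k * pochhammer \<alpha> k / fact k"
    by (simp add: gbinomial_pochhammer)
  have 3: "(1 + x) powr (\<alpha> + real k) = (1 + x) powr \<alpha> * (1 + x) ^ k"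
    using x by (simp add: powr_add powr_realpow)
  have 4: "(- x) ^ k = (- 1) ^ k * x ^ k"
    by (simp flip: power_mult_distrib)
  have "((- x) ^ k / fact k) * (Gamma (\<alpha> + real k) / (1 + x) powr (\<alpha> + real k)) =
      Gamma \<alpha> * (1 + x) powr (- \<alpha>) * (((- \<alpha>) gchoose k) * (x / (1 + x)) ^ k)"
    unfolding 1 2 3 4 by (simp add: powr_minus power_divide divide_inverse mult_ac power_mult_distrib power_inverse)
  moreover have "((1 + x) powr (- \<alpha>)) ^ r = (1 + x) powr (- (real r * \<alpha>))"
    using x by (simp add: powr_power mult.commute)
  moreover have "((x / (1 + x)) ^ k) ^ r = (x / (1 + x)) ^ (r * k)"
    by (simp add: mult.commute flip: power_mult)
  ultimately show ?thesis
    by (simp only: f_series_term_def power_mult_distrib mult.assoc)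
qed

section \<open>The Laplace representation\<close>

text \<open>Summability and integrability are asserted with the formula because
  \<open>suminf\<close> and the integral are total and take default values when convergence
  fails.\<close>

theorem theorem3p1:
  fixes r :: nat and \<alpha> x :: real
  assumes "r > 1" and "\<alpha> > 0" and "x \<ge> 0"
  shows "summable (f_series_term r \<alpha> x) \<and>
    set_integrable (lborel_n r \<Otimes>\<^sub>M lborel_n (r - 1)) (positive_orthant r \<times> angle_box (r - 1))
      (laplace_integrand r \<alpha> x) \<and>
    complex_of_real (f_alpha r \<alpha> x) =
      complex_of_real (1 / ((2 * pi) ^ (r - 1) * Gamma \<alpha> ^ r)) *
      (LINT p:positive_orthant r \<times> angle_box (r - 1)|(lborel_n r \<Otimes>\<^sub>M lborel_n (r - 1)).
        laplace_integrand r \<alpha> x p)"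
proof -
  let ?M = "lborel_n r \<Otimes>\<^sub>M lborel_n (r - 1)"
  let ?A = "positive_orthant r \<times> angle_box (r - 1)"
  have r: "r > 0"
    using assms(1) by simp
  \<comment> \<open>These are, in order, the measurability, majorant, pointwise sum and bound
    required for termwise integration.\<close>
  note dom = measurable_laplace_term integrable_majorant[OF assms(2)] laplace_term_sums
    laplace_term_sum_norm_le[OF r assms(3)]
  define I where "I = (LINT p:?A|?M. laplace_integrand r \<alpha> x p)"
  define K where "K = (2 * pi) ^ (r - 1) * Gamma \<alpha> ^ r"
  define K' where "K' = K * (1 + x) powr (- (real r * \<alpha>))"
  have K: "K \<noteq> 0" "K' \<noteq> 0"
    using assms(3) Gamma_real_pos[OF assms(2), THEN less_imp_neq] by (auto simp: K_def K'_def)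
  have int: "set_integrable ?M ?A (laplace_integrand r \<alpha> x)"
    unfolding set_integrable_def by (rule dominated_integrable_sums[OF dom])
  have "(\<lambda>k. integral\<^sup>L ?M (laplace_term r \<alpha> x k)) sums I"
    unfolding I_def set_lebesgue_integral_def by (rule dominated_integral_sums[OF dom])
  also have "(\<lambda>k. integral\<^sup>L ?M (laplace_term r \<alpha> x k)) = (\<lambda>k. of_real (K' * f_series_term r \<alpha> x k))"
    by (simp only: integral_laplace_term[OF r assms(2,3) dominated_integrable_term[OF dom]]
        f_series_term_Gamma[OF assms(2,3)] K_def K'_def)
  finally have sums: "(\<lambda>k. complex_of_real (K' * f_series_term r \<alpha> x k)) sums I" .
  \<comment> \<open>Convergence of the series needs no separate test: the term integrals are
    summable, and they are the series terms times the nonzero constant \<open>K'\<close>.\<close>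
  have "(\<lambda>k. K' * f_series_term r \<alpha> x k) sums Re I"
    using sums_Re[OF sums] by simp
  then have summable: "summable (f_series_term r \<alpha> x)"
    using K by (simp add: sums_iff summable_cmult_iff)
  then have "(\<lambda>k. complex_of_real (K' * f_series_term r \<alpha> x k)) sums
      complex_of_real (K' * (\<Sum>k. f_series_term r \<alpha> x k))"
    by (intro sums_of_real sums_mult summable_sums)
  with sums have "I = complex_of_real (K' * (\<Sum>k. f_series_term r \<alpha> x k))"
    by (rule sums_unique2)
  then have "I = complex_of_real (K * f_alpha r \<alpha> x)"
    by (simp only: K'_def f_alpha_def mult.assoc)
  then have "complex_of_real (f_alpha r \<alpha> x) = complex_of_real (1 / K) * I"
    using K by simp
  with summable int show ?thesis
    unfolding I_def K_def by blast
qed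

end
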